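(* Let $E$ be a separable F-space over $\mathbb{C}$. Then $E$ satisfies $(C_0)$, the countable intersection property for subspaces: whenever $(M_i)_{i\in I}$ is a family of closed linear subspaces of $E$ with $\bigcap_{i\in I} M_i=\{0\}$, there is a countable set of indices $I_0\subset I$ such that $\bigcap_{i\in I_0} M_i=\{0\}$.
   Context: Topological vector spaces (TVS) are over the complex numbers and are assumed Hausdorff and complete. An F-space is a complete and metrizable TVS whose metric is translation-invariant (no local convexity is assumed). *)

theory Defs
  imports "HOL-Analysis.Analysis"
begin

text \<open>
  A Hausdorff topological vector space over the complex numbers. Continuity of addition and
  negation is part of the class \<open>topological_ab_group_add\<close>.
\<close>

locale complex_tvs = vector_space scale
  for scale :: "complex \<Rightarrow> 'a::{topological_ab_group_add, t2_space} \<Rightarrow> 'a" (infixr "*\<^sub>C" 75) +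
  assumes continuous_scale: "continuous_on UNIV (\<lambda>(c, x). c *\<^sub>C x)"

text \<open>
  The metric of an F-space is the \<open>dist\<close> of the type; it induces the topology and is complete
  by the class \<open>complete_space\<close>. Local convexity is not assumed.
\<close>

locale complex_F_space = complex_tvs scale
  for scale :: "complex \<Rightarrow> 'a::{complete_space, topological_ab_group_add} \<Rightarrow> 'a" (infixr "*\<^sub>C" 75) +
  assumes dist_translation_invariant: "dist (x + z) (y + z) = dist x (y :: 'a)"

end

theory Submission
  imports Defs
begin

text \<open>
  The statement is topological: a separable metric space is second countable, hence every subset
  of it is a Lindelof space. If closed sets \<open>M i\<close> intersect in \<open>{0}\<close>, their complements form an
  open cover of \<open>E - {0}\<close>, and a countable subcover is a countable subfamily of the \<open>M i\<close> whose
  intersection is still \<open>{0}\<close>.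
\<close>

text \<open>
  The balls of radius \<open>1/(n+1)\<close> around the points of a countable dense set form a base.
\<close>

lemma separable_metric_imp_second_countable:
  assumes "separable_space (euclidean :: 'a::metric_space topology)"
  shows "second_countable (euclidean :: 'a topology)"
proof -
  obtain C :: "'a set" where C: "countable C" "closure C = UNIV"
    using assms by (auto simp: separable_space_def)
  define \<B> where "\<B> = (\<lambda>(c, n). ball c (1 / real (Suc n))) ` (C \<times> UNIV)"
  have "\<exists>V\<in>\<B>. x \<in> V \<and> V \<subseteq> U" if U: "open U" "x \<in> U" for U x
  proof -
    obtain e where e: "e > 0" "ball x e \<subseteq> U"
      using U open_contains_ball by blast
    \<comment> \<open>A ball of radius less than \<open>e/2\<close> that contains \<open>x\<close> lies in the ball of radius \<open>e\<close> around \<open>x\<close>.\<close>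
    obtain n where n: "1 / real (Suc n) < e / 2"
      using e(1) nat_approx_posE[of "e / 2"] by auto
    have "x \<in> closure C"
      using C(2) by simp
    then obtain c where c: "c \<in> C" "dist c x < 1 / real (Suc n)"
      unfolding closure_approachable
      by (metis of_nat_0_less_iff zero_less_Suc zero_less_divide_1_iff)
    have "ball c (1 / real (Suc n)) \<subseteq> ball x e"
    proof
      fix y assume "y \<in> ball c (1 / real (Suc n))"
      moreover have "dist x y \<le> dist c x + dist c y"
        by (metis dist_commute dist_triangle)
      ultimately show "y \<in> ball x e"
        using c(2) n unfolding mem_ball by linarith
    qed
    moreover have "ball c (1 / real (Suc n)) \<in> \<B>"
      using c(1) by (force simp: \<B>_def)
    ultimately show ?thesis
      using c(2) e(2) by (intro bexI[of _ "ball c (1 / real (Suc n))"]) auto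
  qed
  moreover have "countable \<B>"
    using C(1) by (simp add: \<B>_def)
  moreover have "open V" if "V \<in> \<B>" for V
    using that by (auto simp: \<B>_def)
  ultimately show ?thesis
    unfolding second_countable_def open_openin[symmetric] by blast
qed

text \<open>
  Dual form of the fact that every subspace of a second countable space is Lindelof, applied to the
  complement of the intersection. Intersecting with \<^term>\<open>topspace X\<close> gives the empty
  subfamily the right value.
\<close>

lemma second_countable_Inter_closedin_countable_subfamily:
  assumes "second_countable X"
    and "\<And>i. i \<in> I \<Longrightarrow> closedin X (F i)"
  shows "\<exists>J\<subseteq>I. countable J \<and> topspace X \<inter> (\<Inter>i\<in>J. F i) = topspace X \<inter> (\<Inter>i\<in>I. F i)"
proof -
  define S where "S = topspace X - (\<Inter>i\<in>I. F i)"
  define \<U> where "\<U> = (\<lambda>i. topspace X - F i) ` I"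
  have SX: "S \<subseteq> topspace X"
    by (auto simp: S_def)
  have "Lindelof_space (subtopology X S)"
    by (simp add: assms(1) second_countable_imp_Lindelof_space second_countable_subtopology)
  then have "(\<forall>U\<in>\<U>. openin X U) \<and> S \<subseteq> \<Union>\<U> \<longrightarrow> (\<exists>\<V>. countable \<V> \<and> \<V> \<subseteq> \<U> \<and> S \<subseteq> \<Union>\<V>)"
    unfolding Lindelof_space_subtopology_subset[OF SX] by (rule spec)
  moreover have "\<forall>U\<in>\<U>. openin X U"
    using assms(2) by (auto simp: \<U>_def)
  moreover have "S \<subseteq> \<Union>\<U>"
    by (auto simp: S_def \<U>_def)
  ultimately obtain \<V> where \<V>: "countable \<V>" "\<V> \<subseteq> \<U>" "S \<subseteq> \<Union>\<V>"
    by blast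
  then obtain J where J: "J \<subseteq> I" "countable J" "\<V> = (\<lambda>i. topspace X - F i) ` J"
    unfolding \<U>_def by (metis countable_subset_image)
  have "topspace X \<inter> (\<Inter>i\<in>J. F i) = topspace X \<inter> (\<Inter>i\<in>I. F i)"
    using \<V>(3) J(1) unfolding J(3) S_def by blast
  with J show ?thesis
    by blast
qed

theorem theorem3p1:
  fixes scale :: "complex \<Rightarrow> 'a::{complete_space, topological_ab_group_add} \<Rightarrow> 'a"
    and I :: "'i set"
    and M :: "'i \<Rightarrow> 'a set"
  assumes "complex_F_space scale"
    and "separable_space (euclidean :: 'a topology)"
    and "\<And>i. i \<in> I \<Longrightarrow> module.subspace scale (M i)"
    and "\<And>i. i \<in> I \<Longrightarrow> closed (M i)"
    and "(\<Inter>i\<in>I. M i) = {0}"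
  shows "\<exists>I\<^sub>0\<subseteq>I. countable I\<^sub>0 \<and> (\<Inter>i\<in>I\<^sub>0. M i) = {0}"
proof -
  have "second_countable (euclidean :: 'a topology)"
    using assms(2) by (rule separable_metric_imp_second_countable)
  moreover have "closedin euclidean (M i)" if "i \<in> I" for i
    using assms(4)[OF that] by simp
  ultimately obtain J where "J \<subseteq> I" "countable J"
      "topspace euclidean \<inter> (\<Inter>i\<in>J. M i) = topspace euclidean \<inter> (\<Inter>i\<in>I. M i)"
    using second_countable_Inter_closedin_countable_subfamily[of euclidean I M] by blast
  with assms(5) show ?thesis
    by auto
qed

end
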